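(* Let $K\subset\mathbb R^n$ be a generating set, and let $X_0, X_1,\ldots, X_n\subset \mathbb R^n$ be finite sets. Suppose that every system of representatives $x_0\in X_0$, $x_1\in X_1$, $\ldots$, $x_n\in X_n$ can be separated from the origin by a translate $K-t$ ($t\in\mathbb R^n$). Then there exist an index $0\le i\le n$ and a translate of $K$ that separates $X_i$ from the origin.
   Context: A convex body is a compact convex subset of $\mathbb R^n$ with nonempty interior; a convex compactum is a compact convex set. For a convex body $K$ and a set $T\subset\mathbb R^n$ write $K\dot{-}T=\bigcap_{t\in T}(K-t)$. A convex body $K$ is a generating set if for every $T\subset\mathbb R^n$ with $K\dot{-}T\neq\emptyset$, the set $K\dot{-}T$ is a Minkowski summand of $K$, i.e. $(K\dot{-}T)+T'=K$ for some convex compactum $T'$. A translate $K-t$ separates a set $S$ from a set $C$ (e.g. from the origin, $C=\{0\}$) if $S\subseteq K-t$ and $(K-t)\cap C=\emptyset$. *)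

theory Defs
  imports "HOL-Analysis.Analysis" "HOL-Library.Set_Algebras"
begin

definition convex_body :: "'a::euclidean_space set \<Rightarrow> bool" where
  "convex_body K \<longleftrightarrow> compact K \<and> convex K \<and> interior K \<noteq> {}"

definition translate_by :: "'a::euclidean_space set \<Rightarrow> 'a \<Rightarrow> 'a set" where
  "translate_by K t = (\<lambda>x. x - t) ` K"

definition minkowski_diff :: "'a::euclidean_space set \<Rightarrow> 'a set \<Rightarrow> 'a set" where
  "minkowski_diff K T = (\<Inter>t\<in>T. translate_by K t)"

text \<open>Minkowski sums of sets are the pointwise sums of Set_Algebras.\<close>

definition minkowski_summand :: "'a::euclidean_space set \<Rightarrow> 'a set \<Rightarrow> bool" where
  "minkowski_summand A K \<longleftrightarrow> (\<exists>T'. compact T' \<and> convex T' \<and> A + T' = K)"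

text \<open>The set \<open>T\<close> has to be nonempty: the empty intersection is the whole space, which is
  not a summand of any compact set, so admitting \<open>T = {}\<close> would leave no generating sets.\<close>

definition generating_set :: "'a::euclidean_space set \<Rightarrow> bool" where
  "generating_set K \<longleftrightarrow> convex_body K \<and>
     (\<forall>T. T \<noteq> {} \<and> minkowski_diff K T \<noteq> {} \<longrightarrow> minkowski_summand (minkowski_diff K T) K)"

definition separates_from :: "'a set \<Rightarrow> 'a set \<Rightarrow> 'a set \<Rightarrow> bool" where
  "separates_from A S C \<longleftrightarrow> S \<subseteq> A \<and> A \<inter> C = {}"

end

theory Submission
  imports Defs
begin

text \<open>
  Since \<open>S \<subseteq> K - t\<close> means \<open>t \<in> K \<ominus> S\<close> (Minkowski difference), a set \<open>S\<close> is separated from the origin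
  by a translate iff some direction \<open>u\<close> is larger at a point of \<open>K \<ominus> S\<close> than on all of \<open>K\<close>. Because
  \<open>(K \<ominus> S) + M = K\<close> for some \<open>M\<close>, these directions are those that are negative on \<open>M\<close>, so they form
  a convex cone; it grows when \<open>S\<close> shrinks.

  Suppose that all systems of representatives are separated but no \<open>X i\<close> is. Cover the space by \<open>n + 1\<close>
  colour classes of disjoint tiny cubes, and assign to each cube \<open>Q\<close> of colour \<open>i\<close> that stays away from
  \<open>K\<close> a representative \<open>x \<in> X i\<close> such that \<open>K - x\<close> misses \<open>Q\<close>. The cubes around \<open>t\<close> then give a
  partial system of representatives, and convexity of the cones lets the separating directions be
  interpolated continuously in \<open>t\<close>. Let \<open>\<Phi> t\<close> consist of the points of \<open>K \<ominus> S\<close> beyond \<open>K\<close> in the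
  interpolated direction, where \<open>S\<close> collects the representatives of the heaviest colours at \<open>t\<close>.
  Browder's theorem gives a fixed point \<open>t \<in> \<Phi> t\<close>. It lies away from \<open>K\<close> but in \<open>K - x\<close>
  for the representative \<open>x\<close> of a cube containing \<open>t\<close>, a contradiction.
\<close>

section \<open>Fixed points of set-valued maps\<close>

text \<open>Constant selections on finitely many balls are averaged by a partition of unity into a
  continuous self-map of \<open>B\<close>. At a Brouwer fixed point \<open>t\<close> only balls
  containing \<open>t\<close> contribute, so \<open>f t\<close> averages points of the convex set
  \<open>\<Phi> t\<close>.\<close>

lemma browder_fixed_point:
  fixes \<Phi> :: "'a::euclidean_space \<Rightarrow> 'a set"
  assumes B: "compact B" "convex B" "B \<noteq> {}"
    and conv: "\<And>t. t \<in> B \<Longrightarrow> convex (\<Phi> t)"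
    and sel: "\<And>t. t \<in> B \<Longrightarrow> \<exists>y\<in>B. \<forall>\<^sub>F s in nhds t. y \<in> \<Phi> s"
  shows "\<exists>t\<in>B. t \<in> \<Phi> t"
proof -
  have "\<exists>y r. y \<in> B \<and> r > 0 \<and> (\<forall>s. dist s t < r \<longrightarrow> y \<in> \<Phi> s)" if "t \<in> B" for t
    using sel[OF that] by (auto simp: eventually_nhds_metric)
  then obtain y r where yr: "\<And>t. t \<in> B \<Longrightarrow> y t \<in> B"  "\<And>t. t \<in> B \<Longrightarrow> r t > (0::real)"
      "\<And>t s. t \<in> B \<Longrightarrow> dist s t < r t \<Longrightarrow> y t \<in> \<Phi> s"
    by metis
  have "B \<subseteq> (\<Union>t\<in>B. ball t (r t))"
    using yr(2) by auto
  then obtain D where D: "D \<subseteq> B" "finite D" "B \<subseteq> (\<Union>t\<in>D. ball t (r t))"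
    using compactE_image[OF B(1), of B "\<lambda>t. ball t (r t)"] by (metis open_ball)
  define \<beta> where "\<beta> = (\<lambda>d t. max 0 (r d - dist t d))"
  define s where "s = (\<lambda>t. \<Sum>d\<in>D. \<beta> d t)"
  define f where "f = (\<lambda>t. \<Sum>d\<in>D. (\<beta> d t / s t) *\<^sub>R y d)"
  have \<beta>0: "\<beta> d t \<ge> 0" for d t
    by (simp add: \<beta>_def)
  have s0: "s t > 0" if "t \<in> B" for t
  proof -
    obtain d where "d \<in> D" "dist t d < r d"
      using D(3) \<open>t \<in> B\<close> by (auto simp: dist_commute)
    then show ?thesis
      unfolding s_def using D(2) \<beta>0 by (intro sum_pos2[of D d]) (auto simp: \<beta>_def)
  qed
  have s1: "(\<Sum>d\<in>D. \<beta> d t / s t) = 1" if "t \<in> B" for t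
    using s0[OF that] by (simp add: s_def flip: sum_divide_distrib)
  have "continuous_on B f"
    unfolding f_def s_def \<beta>_def
    by (intro continuous_intros) (use s0 in \<open>auto simp: s_def \<beta>_def less_imp_neq[THEN not_sym]\<close>)
  moreover have "f \<in> B \<rightarrow> B"
  proof
    fix t assume t: "t \<in> B"
    show "f t \<in> B" unfolding f_def
      by (rule convex_sum[OF D(2) B(2) s1[OF t]])
        (use s0[OF t] \<beta>0 yr(1) D(1) in \<open>auto intro: divide_nonneg_pos\<close>)
  qed
  ultimately obtain t where t: "t \<in> B" "f t = t"
    using brouwer[OF B(1,2,3)] by blast
  let ?D = "{d\<in>D. dist t d < r d}"
  have "f t = (\<Sum>d\<in>?D. (\<beta> d t / s t) *\<^sub>R y d)"
    unfolding f_def using D(2) by (intro sum.mono_neutral_right) (auto simp: \<beta>_def)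
  also have "\<dots> \<in> \<Phi> t"
  proof (rule convex_sum)
    have "(\<Sum>d\<in>?D. \<beta> d t / s t) = (\<Sum>d\<in>D. \<beta> d t / s t)"
      using D(2) by (intro sum.mono_neutral_left) (auto simp: \<beta>_def)
    then show "(\<Sum>d\<in>?D. \<beta> d t / s t) = 1"
      using s1[OF t(1)] by simp
  qed (use D s0[OF t(1)] \<beta>0 yr(3) conv t in \<open>auto intro: divide_nonneg_pos\<close>)
  finally show ?thesis
    using t by auto
qed

section \<open>Coloured cubical grids\<close>

text \<open>Colour \<open>i\<close> is the cubical grid shifted by \<open>i / (n + 1)\<close> along the diagonal: each of the \<open>n\<close>
  coordinates of a point is on a wall for at most one of the \<open>n + 1\<close> colours.\<close>

lemma grid_colouring:
  fixes \<epsilon> :: real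
  assumes "\<epsilon> > 0"
  obtains w :: "nat \<Rightarrow> real ^ 'n \<Rightarrow> real" and q :: "nat \<Rightarrow> real ^ 'n \<Rightarrow> int ^ 'n"
  where "\<And>i. continuous_on UNIV (w i)"
    and "\<And>i t. w i t \<ge> 0"
    and "\<And>t. \<exists>i\<le>CARD('n). w i t > 0"
    and "\<And>i t. w i t > 0 \<Longrightarrow> \<forall>\<^sub>F s in nhds t. q i s = q i t"
    and "\<And>i s t. q i s = q i t \<Longrightarrow> dist s t \<le> \<epsilon>"
proof -
  define N where "N = CARD('n)"
  \<comment> \<open>Two points of a cube of side \<open>h\<close> are at l1-distance at most
    \<open>N * h = \<epsilon>\<close>.\<close>
  define h where "h = \<epsilon> / N"
  have N: "N > 0" by (simp add: N_def)
  have h: "h > 0" using assms N by (simp add: h_def)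
  define z where "z = (\<lambda>i (t :: real^'n) j. t $ j / h - real i / real (N + 1))"
  \<comment> \<open>\<open>sin (pi * r)\<close> vanishes exactly at integers \<open>r\<close>, so
    \<open>w i\<close> vanishes exactly on the walls of colour \<open>i\<close>.\<close>
  define w where "w = (\<lambda>i t. \<Prod>j\<in>UNIV. \<bar>sin (pi * z i t j)\<bar>)"
  define q where "q = (\<lambda>i t. \<chi> j. \<lfloor>z i t j\<rfloor>)"
  have zero: "w i t = 0 \<longleftrightarrow> (\<exists>j. z i t j \<in> \<int>)" for i t
  proof -
    have "sin (pi * x) = 0 \<longleftrightarrow> x \<in> \<int>" for x
      by (auto simp: sin_zero_iff_int2 Ints_def mult.commute)
    then show ?thesis by (simp add: w_def)
  qed
  have z_cont: "isCont (\<lambda>t. z i t j) t" for i j t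
    unfolding z_def by (intro continuous_intros) (use h in auto)
  have w0: "w i t \<ge> 0" for i t
    unfolding w_def by (intro prod_nonneg) auto
  show ?thesis
  proof
    show "continuous_on UNIV (w i)" for i
      unfolding w_def z_def using h by (intro continuous_intros) auto
    show "w i t \<ge> 0" for i t by (rule w0)
    show "\<exists>i\<le>CARD('n). w i t > 0" for t
    proof (rule ccontr)
      assume "\<not> ?thesis"
      then have "\<forall>i\<in>{..N}. \<exists>j. z i t j \<in> \<int>"
        using w0 zero by (metis N_def atMost_iff order_le_less)
      then obtain b where b: "\<And>i. i \<le> N \<Longrightarrow> z i t (b i) \<in> \<int>"
        by (metis atMost_iff)
      \<comment> \<open>Pigeonhole: two colours \<open>i < k\<close> share a coordinate, where their
        integer values of \<open>z\<close> differ by \<open>(k - i) / (N + 1)\<close>, strictly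
        between 0 and 1.\<close>
      have "\<not> inj_on b {..N}"
      proof
        assume "inj_on b {..N}"
        then have "card {..N} \<le> CARD('n)"
          by (rule card_inj_on_le) auto
        then show False by (simp add: N_def)
      qed
      then obtain i k where ik: "i < k" "k \<le> N" "b i = b k"
        by (metis atMost_iff inj_onI linorder_neqE_nat)
      have "z i t (b i) - z k t (b k) \<in> \<int>"
        using b[of i] b[of k] ik by (intro Ints_diff) auto
      moreover have "z i t (b i) - z k t (b k) = real (k - i) / real (N + 1)"
        using ik by (simp add: z_def of_nat_diff diff_divide_distrib)
      ultimately obtain m where "real (k - i) / real (N + 1) = of_int m"
        by (auto elim: Ints_cases)
      moreover have "0 < real (k - i) / real (N + 1)" "real (k - i) / real (N + 1) < 1"
        using ik by auto
      ultimately have "0 < m" "m < 1"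
        by linarith+
      then show False
        by simp
    qed
    show "\<forall>\<^sub>F s in nhds t. q i s = q i t" if "w i t > 0" for i t
    proof -
      have "\<forall>\<^sub>F s in nhds t. \<lfloor>z i s j\<rfloor> = \<lfloor>z i t j\<rfloor>" for j
      proof -
        have "z i t j \<notin> \<int>" using that zero[of i t] by auto
        then have "of_int \<lfloor>z i t j\<rfloor> < z i t j"
          by (metis Ints_of_int antisym_conv2 of_int_floor_le)
        moreover have "z i t j < of_int \<lfloor>z i t j\<rfloor> + 1"
          by linarith
        moreover have "((\<lambda>s. z i s j) \<longlongrightarrow> z i t j) (nhds t)"
          using z_cont by (simp add: isCont_def tendsto_nhds_iff)
        ultimately have "\<forall>\<^sub>F s in nhds t. of_int \<lfloor>z i t j\<rfloor> < z i s j \<and> z i s j < of_int \<lfloor>z i t j\<rfloor> + 1"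
          by (intro eventually_conj order_tendstoD)
        then show ?thesis
          by eventually_elim (auto simp: floor_eq_iff)
      qed
      then have "\<forall>\<^sub>F s in nhds t. \<forall>j. \<lfloor>z i s j\<rfloor> = \<lfloor>z i t j\<rfloor>"
        by (simp add: eventually_all_finite)
      then show ?thesis
        by eventually_elim (simp add: q_def)
    qed
    show "dist s t \<le> \<epsilon>" if "q i s = q i t" for i s t
    proof -
      have "\<bar>s $ j - t $ j\<bar> \<le> h" for j
      proof -
        have "\<lfloor>z i s j\<rfloor> = \<lfloor>z i t j\<rfloor>"
          using that by (simp add: q_def vec_eq_iff)
        then have "\<bar>z i s j - z i t j\<bar> \<le> 1"
          by linarith
        then have "\<bar>s $ j - t $ j\<bar> / h \<le> 1"
          using h by (simp add: z_def flip: diff_divide_distrib)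
        then show ?thesis
          using h by simp
      qed
      then have "(\<Sum>j\<in>UNIV. \<bar>(s - t) $ j\<bar>) \<le> (\<Sum>j\<in>(UNIV::'n set). h)"
        by (intro sum_mono) simp
      also have "\<dots> = \<epsilon>"
        using N by (simp add: h_def N_def)
      finally show ?thesis
        using norm_le_l1_cart[of "s - t"] by (simp add: dist_norm)
    qed
  qed
qed

section \<open>Minkowski differences and separating directions\<close>

lemma mem_minkowski_diff: "y \<in> minkowski_diff K S \<longleftrightarrow> (\<forall>s\<in>S. s + y \<in> K)"
  by (force simp: minkowski_diff_def translate_by_def algebra_simps image_iff)

lemma separates_from_origin:
  "separates_from (translate_by K t) S {0} \<longleftrightarrow> t \<in> minkowski_diff K S \<and> t \<notin> K"
  by (force simp: mem_minkowski_diff separates_from_def translate_by_def algebra_simps image_iff)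

text \<open>Split a maximiser of \<open>v\<close> on \<open>K\<close> as \<open>l + m\<close> along
  the summand. Each \<open>y a + m\<close> lies in \<open>K\<close>, which forces
  \<open>m \<bullet> u a \<le> -1\<close>; summing, \<open>l\<close> exceeds the maximum by at least
  \<open>sum c A\<close>.\<close>

lemma generating_set_separating_combination:
  assumes "generating_set K" "S \<noteq> {}" "finite A" "A \<noteq> {}"
    and c: "\<And>a. a \<in> A \<Longrightarrow> c a \<ge> (0::real)"
    and y: "\<And>a. a \<in> A \<Longrightarrow> y a \<in> minkowski_diff K S"
    and u: "\<And>a k. a \<in> A \<Longrightarrow> k \<in> K \<Longrightarrow> k \<bullet> u a + 1 \<le> y a \<bullet> u a"
  defines "v \<equiv> \<Sum>a\<in>A. c a *\<^sub>R u a"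
  shows "\<exists>l\<in>minkowski_diff K S. \<forall>k\<in>K. k \<bullet> v + sum c A \<le> l \<bullet> v"
proof -
  have "minkowski_diff K S \<noteq> {}"
    using y \<open>A \<noteq> {}\<close> by auto
  then obtain M where M: "minkowski_diff K S + M = K"
    using assms(1,2) by (auto simp: generating_set_def minkowski_summand_def)
  have "compact K" "K \<noteq> {}"
    using assms(1) by (auto simp: generating_set_def convex_body_def)
  then obtain k0 where k0: "k0 \<in> K" "\<And>k. k \<in> K \<Longrightarrow> k \<bullet> v \<le> k0 \<bullet> v"
    using continuous_attains_sup[of K "\<lambda>k. k \<bullet> v"] by (force intro: continuous_intros)
  then obtain l m where lm: "l \<in> minkowski_diff K S" "m \<in> M" "k0 = l + m"
    using M by (metis set_plus_elim)
  have "m \<bullet> u a \<le> - 1" if "a \<in> A" for a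
  proof -
    have "y a + m \<in> K"
      using M lm(2) y[OF that] by (metis set_plus_intro)
    from u[OF that this] show ?thesis
      by (simp add: inner_add_left)
  qed
  then have "(\<Sum>a\<in>A. c a * (m \<bullet> u a)) \<le> (\<Sum>a\<in>A. c a * - 1)"
    using c by (intro sum_mono mult_left_mono) auto
  then have "m \<bullet> v \<le> - sum c A"
    by (simp add: v_def inner_sum_right sum_negf)
  then show ?thesis
    using k0 lm by (intro bexI[of _ l]) (force simp: inner_add_left)+
qed

text \<open>Lets a direction jump where its weight vanishes: boundedness of \<open>v\<close> then
  sends the product to 0.\<close>

lemma isCont_scaleR_locally_const:
  fixes c :: "'a::t2_space \<Rightarrow> real" and v :: "'a \<Rightarrow> 'b::real_normed_vector"
  assumes c: "isCont c t"
    and v: "c t \<noteq> 0 \<Longrightarrow> \<forall>\<^sub>F s in nhds t. v s = v t"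
    and bd: "\<And>s. norm (v s) \<le> C"
  shows "isCont (\<lambda>s. c s *\<^sub>R v s) t"
proof (cases "c t = 0")
  case True
  have "((\<lambda>s. c s *\<^sub>R v s) \<longlongrightarrow> 0) (at t)"
  proof (rule Lim_null_comparison)
    show "\<forall>\<^sub>F s in at t. norm (c s *\<^sub>R v s) \<le> \<bar>c s\<bar> * C"
      using bd by (auto intro!: always_eventually mult_left_mono)
    have "(c \<longlongrightarrow> 0) (at t)"
      using c True by (simp add: isCont_def)
    then show "((\<lambda>s. \<bar>c s\<bar> * C) \<longlongrightarrow> 0) (at t)"
      using tendsto_mult_left_zero tendsto_rabs_zero by blast
  qed
  then show ?thesis
    using True by (simp add: isCont_def)
next
  case False
  then have "\<forall>\<^sub>F s in nhds t. c s *\<^sub>R v s = c s *\<^sub>R v t"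
    using v by (auto elim: eventually_mono)
  then show ?thesis
    using c by (subst isCont_cong[of _ "\<lambda>s. c s *\<^sub>R v t"]) (auto intro: continuous_intros)
qed

text \<open>Scaling the normal of a strictly separating hyperplane makes the gap at least 1, so that
  margins add up with the weights.\<close>

lemma separating_functional:
  fixes K :: "'a::euclidean_space set"
  assumes "compact K" "convex K" "t \<notin> K"
  shows "\<exists>u. \<forall>k\<in>K. k \<bullet> u + 1 \<le> t \<bullet> u"
proof -
  obtain a b where ab: "a \<bullet> t < b" "\<And>k. k \<in> K \<Longrightarrow> b < a \<bullet> k"
    using separating_hyperplane_closed_point[of K t] assms compact_imp_closed by blast
  define e where "e = b - a \<bullet> t"
  have e: "e > 0" using ab by (simp add: e_def)
  have "k \<bullet> (- a /\<^sub>R e) + 1 \<le> t \<bullet> (- a /\<^sub>R e)" if "k \<in> K" for k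
  proof -
    have "e \<le> a \<bullet> k - a \<bullet> t"
      using ab(2)[OF that] by (simp add: e_def)
    then have "1 \<le> (a \<bullet> k - a \<bullet> t) / e"
      using e by simp
    then show ?thesis
      by (simp add: inner_commute divide_inverse algebra_simps)
  qed
  then show ?thesis by blast
qed

theorem theorem1p3:
  fixes K :: "(real ^ 'n) set" and X :: "nat \<Rightarrow> (real ^ 'n) set"
  assumes "generating_set K"
    and "\<And>i. i \<le> CARD('n) \<Longrightarrow> finite (X i)"
    and "\<And>x. (\<And>i. i \<le> CARD('n) \<Longrightarrow> x i \<in> X i) \<Longrightarrow>
           \<exists>t. separates_from (translate_by K t) (x ` {0..CARD('n)}) {0}"
  shows "\<exists>i\<le>CARD('n). \<exists>t. separates_from (translate_by K t) (X i) {0}"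
proof (rule ccontr)
  assume "\<not> ?thesis"
  then have nonsep: "\<exists>x\<in>X i. x + t \<notin> K" if "i \<le> CARD('n)" "t \<notin> K" for i t
    using that by (auto simp: separates_from_origin mem_minkowski_diff)
  define N where "N = CARD('n)"
  define V where "V = (\<Union>i\<le>N. X i)"
  have K: "compact K" "convex K"
    using assms(1) by (auto simp: generating_set_def convex_body_def)
  have finV: "finite V"
    using assms(2) by (auto simp: V_def N_def)
  obtain t0 where "t0 \<notin> K"
    using K(1) compact_imp_bounded not_bounded_UNIV by (metis UNIV_eq_I)
  then have Xne: "X i \<noteq> {}" if "i \<le> N" for i
    using nonsep that by (auto simp: N_def)

  \<comment> \<open>Directions for systems of representatives\<close>
  define sep where "sep = (\<lambda>S y u. y \<in> minkowski_diff K S \<and> (\<forall>k\<in>K. k \<bullet> u + 1 \<le> y \<bullet> u))"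
  have sep_ex: "\<exists>u y. sep (x ` T) y u" if "T \<subseteq> {..N}" and x: "\<And>i. i \<le> N \<Longrightarrow> x i \<in> X i" for T x
  proof -
    obtain y where y: "y \<in> minkowski_diff K (x ` {0..N})" "y \<notin> K"
      using assms(3)[of x] x unfolding separates_from_origin N_def by blast
    moreover have "y \<in> minkowski_diff K (x ` T)"
      using y(1) that(1) by (auto simp: mem_minkowski_diff)
    ultimately show ?thesis
      using separating_functional[OF K, of y] by (auto simp: sep_def)
  qed
  \<comment> \<open>The choice depends only on the set \<open>S\<close>: it takes finitely many
    values on subsets of \<open>V\<close>, and it is constant as long as the representatives
    are.\<close>
  define U where "U = (\<lambda>S. SOME u. \<exists>y. sep S y u)"
  have U: "\<exists>y. sep (x ` T) y (U (x ` T))" if "T \<subseteq> {..N}" "\<And>i. i \<le> N \<Longrightarrow> x i \<in> X i" for T x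
    unfolding U_def by (rule someI_ex[OF sep_ex[OF that]])
  obtain C where C: "C > 0" "\<And>S. S \<subseteq> V \<Longrightarrow> norm (U S) \<le> C"
  proof -
    have "bounded (U ` Pow V)"
      using finV by (intro finite_imp_bounded) auto
    then show ?thesis
      using that by (force simp: bounded_pos)
  qed
  \<comment> \<open>The bound covers \<open>K\<close> and every translate of it by an element of
    \<open>V\<close>, so the ball \<open>B\<close> will contain all selected points.\<close>
  obtain R where R: "R > 0" "\<And>k. k \<in> K \<Longrightarrow> norm k \<le> R" "\<And>k s. s + k \<in> K \<Longrightarrow> s \<in> V \<Longrightarrow> norm k \<le> R"
  proof -
    obtain r where r: "r > 0" "\<And>k. k \<in> K \<Longrightarrow> norm k \<le> r"
      using K(1) compact_imp_bounded by (force simp: bounded_pos)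
    obtain r' where r': "r' > 0" "\<And>k. k \<in> V \<Longrightarrow> norm k \<le> r'"
      using finV finite_imp_bounded by (force simp: bounded_pos)
    have "norm k \<le> r + r'" if "s + k \<in> K" "s \<in> V" for k s
      using r(2)[OF that(1)] r'(2)[OF that(2)] norm_triangle_ineq4[of "s + k" s] by simp
    moreover have "norm k \<le> r + r'" if "k \<in> K" for k
      using r(2)[OF that] r'(1) by simp
    ultimately show ?thesis
      using that[of "r + r'"] r(1) r'(1) by simp
  qed
  define B where "B = cball (0::real^'n) R"
  \<comment> \<open>The distance \<open>1 / (2 * C)\<close> is what the final estimate gives for the
    fixed point. Being compact and disjoint from \<open>K\<close>, \<open>P\<close> admits a
    Lebesgue number.\<close>
  define P where "P = {t\<in>B. \<forall>k\<in>K. 1 / (2 * C) \<le> dist t k}"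
  have "P = B \<inter> (\<Inter>k\<in>K. {t. 1 / (2 * C) \<le> dist t k})"
    by (auto simp: P_def)
  moreover have "closed {t. 1 / (2 * C) \<le> dist t k}" for k :: "real^'n"
    by (intro closed_Collect_le continuous_intros)
  ultimately have compP: "compact P"
    by (auto simp: B_def intro!: compact_Int_closed)
  have PK: "P \<inter> K = {}"
    using C(1) by (fastforce simp: P_def)

  \<comment> \<open>Scale of the grid and representatives of cubes\<close>
  have "\<exists>d>0. \<forall>T. T \<subseteq> P \<and> diameter T < d \<longrightarrow> (\<exists>x\<in>X i. \<forall>t\<in>T. x + t \<notin> K)" if i: "i \<le> N" for i
  proof -
    define O' where "O' = (\<lambda>x. {t. x + t \<notin> K})"
    have "open (O' x)" for x
    proof -
      have "O' x = - ((+) (- x) ` K)"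
        by (force simp: O'_def image_iff algebra_simps)
      then show ?thesis
        using compact_imp_closed[OF compact_translation[OF K(1), of "- x"]] by (metis open_Compl)
    qed
    moreover have "P \<subseteq> \<Union> (O' ` X i)"
      using nonsep[of i] that PK by (auto simp: O'_def N_def)
    moreover have "O' ` X i \<noteq> {}"
      using Xne[OF i] by simp
    ultimately obtain d where "d > 0" and d: "\<And>T. T \<subseteq> P \<Longrightarrow> diameter T < d \<Longrightarrow> \<exists>W\<in>O' ` X i. T \<subseteq> W"
      using Lebesgue_number_lemma[OF compP, of "O' ` X i"] by (metis (no_types, lifting) imageE)
    moreover have "\<exists>x\<in>X i. \<forall>t\<in>T. x + t \<notin> K" if "T \<subseteq> P" "diameter T < d" for T
      using d[OF that] by (auto simp: O'_def)
    ultimately show ?thesis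
      by blast
  qed
  then obtain d where d: "\<And>i. i \<le> N \<Longrightarrow> d i > 0"
      "\<And>i T. i \<le> N \<Longrightarrow> T \<subseteq> P \<Longrightarrow> diameter T < d i \<Longrightarrow> \<exists>x\<in>X i. \<forall>t\<in>T. x + t \<notin> K"
    by metis
  \<comment> \<open>Halving gives the strict inequality \<open>\<epsilon> < d i\<close>, since cells
    may have diameter \<open>\<epsilon>\<close>.\<close>
  define \<epsilon> where "\<epsilon> = Min (d ` {..N}) / 2"
  have \<epsilon>: "\<epsilon> > 0"
    using d(1) by (simp add: \<epsilon>_def)
  have \<epsilon>d: "\<epsilon> < d i" if "i \<le> N" for i
  proof -
    have "Min (d ` {..N}) \<le> d i" using that by simp
    then show ?thesis using \<epsilon> unfolding \<epsilon>_def by linarith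
  qed
  obtain w :: "nat \<Rightarrow> real ^ 'n \<Rightarrow> real" and q :: "nat \<Rightarrow> real ^ 'n \<Rightarrow> int ^ 'n"
    where w_cont: "\<And>i. continuous_on UNIV (w i)"
      and w0: "\<And>i t. w i t \<ge> 0"
      and w_pos: "\<And>t. \<exists>i\<le>N. w i t > 0"
      and q_const: "\<And>i t. w i t > 0 \<Longrightarrow> \<forall>\<^sub>F s in nhds t. q i s = q i t"
      and q_dist: "\<And>i s t. q i s = q i t \<Longrightarrow> dist s t \<le> \<epsilon>"
    unfolding N_def using grid_colouring[OF \<epsilon>] by metis
  have "\<exists>x\<in>X i. \<forall>t\<in>P. q i t = p \<longrightarrow> x + t \<notin> K" if "i \<le> N" for i p
  proof -
    have "diameter {t\<in>P. q i t = p} \<le> \<epsilon>"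
      using \<epsilon> q_dist[of i] by (intro diameter_le) (auto simp: dist_norm)
    then show ?thesis
      using d(2)[OF that, of "{t\<in>P. q i t = p}"] \<epsilon>d[OF that] by auto
  qed
  then obtain \<xi> where \<xi>: "\<And>i p. i \<le> N \<Longrightarrow> \<xi> i p \<in> X i"
      "\<And>i t. i \<le> N \<Longrightarrow> t \<in> P \<Longrightarrow> \<xi> i (q i t) + t \<notin> K"
    by metis
  define x where "x = (\<lambda>t i. \<xi> i (q i t))"
  have xX: "x t i \<in> X i" if "i \<le> N" for t i
    using \<xi>(1) that by (simp add: x_def)
  have xV: "x t ` T \<subseteq> V" if "T \<subseteq> {..N}" for t T
    using xX that by (force simp: V_def)
  have x_const: "\<forall>\<^sub>F s in nhds t. x s i = x t i" if "w i t > 0" for t i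
    using q_const[OF that] by eventually_elim (simp add: x_def)

  \<comment> \<open>Continuous interpolation of directions\<close>
  define TT where "TT = {T. T \<subseteq> {..N} \<and> T \<noteq> {}}"
  have finTT: "finite TT" by (simp add: TT_def)
  \<comment> \<open>The weight \<open>c T t\<close> is positive iff \<open>T\<close> is a superlevel set of \<open>\<lambda>i. w i t\<close> on which \<open>w\<close> is positive.\<close>
  define c where "c = (\<lambda>T t. (\<Prod>i\<in>T. w i t) * (\<Prod>i\<in>T. \<Prod>j\<in>{..N} - T. max 0 (w i t - w j t)))"
  define cc where "cc = (\<lambda>t. \<Sum>T\<in>TT. c T t)"
  define u where "u = (\<lambda>t. \<Sum>T\<in>TT. c T t *\<^sub>R U (x t ` T))"
  have c0: "c T t \<ge> 0" for T t
    unfolding c_def using w0 by (intro mult_nonneg_nonneg prod_nonneg) auto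
  have c_cont: "isCont (c T) t" for T t
  proof -
    have "continuous_on UNIV (c T)"
      unfolding c_def by (intro continuous_intros w_cont)
    then show ?thesis by (simp add: continuous_on_eq_continuous_at)
  qed
  have cc_cont: "isCont cc t" for t
    unfolding cc_def by (intro continuous_intros c_cont)
  have u_cont: "isCont u t" for t
    unfolding u_def
  proof (intro continuous_sum isCont_scaleR_locally_const c_cont)
    fix T assume T: "T \<in> TT"
    then have fin: "finite T" by (auto simp: TT_def intro: finite_subset)
    show "norm (U (x s ` T)) \<le> C" for s
      using T by (intro C(2) xV) (auto simp: TT_def)
    show "\<forall>\<^sub>F s in nhds t. U (x s ` T) = U (x t ` T)" if "c T t \<noteq> 0"
    proof -
      have "\<forall>i\<in>T. w i t > 0"
        using that fin w0 by (auto simp: c_def less_le)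
      then have "\<forall>\<^sub>F s in nhds t. \<forall>i\<in>T. x s i = x t i"
        using fin x_const by (simp add: eventually_ball_finite)
      then show ?thesis
        by eventually_elim (metis image_cong)
    qed
  qed

  define top where "top = (\<lambda>t. {i. i \<le> N \<and> (\<forall>j\<le>N. w j t \<le> w i t)})"
  have top_sub: "top t \<subseteq> {..N}" for t by (auto simp: top_def)
  have top_ne: "top t \<noteq> {}" for t
  proof -
    have "Max ((\<lambda>i. w i t) ` {..N}) \<in> (\<lambda>i. w i t) ` {..N}"
      by (intro Max_in) auto
    then obtain i where "Max ((\<lambda>i. w i t) ` {..N}) = w i t" "i \<in> {..N}"
      by (rule imageE)
    moreover have "w j t \<le> Max ((\<lambda>i. w i t) ` {..N})" if "j \<le> N" for j
      using that by simp
    ultimately have "i \<in> top t" by (simp add: top_def)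
    then show ?thesis by blast
  qed
  have top_pos: "w i t > 0" if "i \<in> top t" for i t
    using that w_pos[of t] by (force simp: top_def)
  have top_c: "c (top t) t > 0" for t
  proof -
    have "w j t < w i t" if "i \<in> top t" "j \<in> {..N} - top t" for i j
      using that by (force simp: top_def not_le)
    then show ?thesis
      unfolding c_def using top_pos by (intro mult_pos_pos prod_pos) auto
  qed
  have cc_pos: "cc t > 0" for t
    unfolding cc_def using top_c c0 top_sub top_ne finTT
    by (intro sum_pos2[of TT "top t"]) (auto simp: TT_def)
  have c_top: "top t \<subseteq> T" if T: "T \<in> TT" "c T t > 0" for T t
  proof
    fix i assume i: "i \<in> top t"
    show "i \<in> T"
    proof (rule ccontr)
      assume "i \<notin> T"
      obtain a where a: "a \<in> T" "a \<le> N" using T(1) by (auto simp: TT_def)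
      have fin: "finite T" using that(1) by (auto simp: TT_def intro: finite_subset)
      have "i \<in> {..N} - T" "max 0 (w a t - w i t) = 0"
        using i a \<open>i \<notin> T\<close> by (auto simp: top_def)
      then have "(\<Prod>j\<in>{..N} - T. max 0 (w a t - w j t)) = 0"
        by (intro prod_zero) auto
      then have "c T t = 0"
        unfolding c_def using a fin by (auto intro!: prod_zero)
      then show False using that(2) by simp
    qed
  qed
  have u_norm: "norm (u t) \<le> C * cc t" for t
  proof -
    have "norm (u t) \<le> (\<Sum>T\<in>TT. c T t * C)"
      unfolding u_def
    proof (rule sum_norm_le)
      fix T assume "T \<in> TT"
      then have "norm (U (x t ` T)) \<le> C" by (intro C(2) xV) (auto simp: TT_def)
      then show "norm (c T t *\<^sub>R U (x t ` T)) \<le> c T t * C"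
        using c0 by (simp add: mult_left_mono)
    qed
    then show ?thesis
      by (simp add: cc_def sum_distrib_left mult.commute)
  qed

  have witness: "\<exists>l\<in>minkowski_diff K (x t ` top t). \<forall>k\<in>K. k \<bullet> u t + cc t \<le> l \<bullet> u t" for t
  proof -
    \<comment> \<open>Enlarging \<open>T\<close> shrinks the Minkowski difference, so every
      \<open>y T\<close> lies in the one for \<open>top t\<close>, and the combination lemma applies
      to that single set.\<close>
    define A where "A = {T\<in>TT. c T t > 0}"
    have "\<exists>y. sep (x t ` T) y (U (x t ` T))" if "T \<in> A" for T
      using that by (intro U xX) (auto simp: A_def TT_def)
    then obtain y where y: "\<And>T. T \<in> A \<Longrightarrow> sep (x t ` T) (y T) (U (x t ` T))"
      by metis
    have "\<exists>l\<in>minkowski_diff K (x t ` top t).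
        \<forall>k\<in>K. k \<bullet> (\<Sum>T\<in>A. c T t *\<^sub>R U (x t ` T)) + (\<Sum>T\<in>A. c T t) \<le> l \<bullet> (\<Sum>T\<in>A. c T t *\<^sub>R U (x t ` T))"
    proof (rule generating_set_separating_combination[OF assms(1)])
      show "x t ` top t \<noteq> {}" using top_ne by auto
      show "finite A" using finTT by (simp add: A_def)
      have "top t \<in> A" using top_c top_sub top_ne by (auto simp: A_def TT_def)
      then show "A \<noteq> {}" by auto
      show "y T \<in> minkowski_diff K (x t ` top t)" if "T \<in> A" for T
        using y[OF that] c_top[of T t] that by (auto simp: A_def sep_def mem_minkowski_diff)
      show "k \<bullet> U (x t ` T) + 1 \<le> y T \<bullet> U (x t ` T)" if "T \<in> A" "k \<in> K" for T k
        using y[OF that(1)] that(2) by (auto simp: sep_def)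
    qed (use c0 in auto)
    moreover have "(\<Sum>T\<in>A. c T t *\<^sub>R U (x t ` T)) = u t"
      unfolding u_def A_def using finTT c0 by (intro sum.mono_neutral_left) (auto simp: less_le)
    moreover have "(\<Sum>T\<in>A. c T t) = cc t"
      unfolding cc_def A_def using finTT c0 by (intro sum.mono_neutral_left) (auto simp: less_le)
    ultimately show ?thesis by simp
  qed

  \<comment> \<open>The set-valued map and its fixed point\<close>
  \<comment> \<open>Asking for only half the margin \<open>cc t\<close> of the witness leaves slack,
    so the same witness serves at nearby points.\<close>
  define \<Phi> where "\<Phi> = (\<lambda>t. {y. (\<forall>i\<in>top t. x t i + y \<in> K) \<and> (\<forall>k\<in>K. k \<bullet> u t + cc t / 2 \<le> y \<bullet> u t)})"
  have "\<exists>t\<in>B. t \<in> \<Phi> t"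
  proof (rule browder_fixed_point)
    show "compact B" "convex B" "B \<noteq> {}" using R(1) by (auto simp: B_def)
    show "convex (\<Phi> t)" for t
    proof -
      have "\<Phi> t = (\<Inter>i\<in>top t. (+) (- x t i) ` K) \<inter> (\<Inter>k\<in>K. {y. k \<bullet> u t + cc t / 2 \<le> u t \<bullet> y})"
        by (force simp: \<Phi>_def image_iff algebra_simps inner_commute)
      then show ?thesis
        using K(2) by (auto intro!: convex_Int convex_INT convex_translation convex_halfspace_ge)
    qed
    fix t
    obtain l where l: "l \<in> minkowski_diff K (x t ` top t)" "\<And>k. k \<in> K \<Longrightarrow> k \<bullet> u t + cc t \<le> l \<bullet> u t"
      using witness by blast
    obtain i where i: "i \<in> top t" using top_ne by auto
    have lR: "norm l \<le> R"
    proof (rule R(3))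
      show "x t i + l \<in> K" using l(1) i by (auto simp: mem_minkowski_diff)
      show "x t i \<in> V" using xV[OF top_sub] i by blast
    qed
    have "\<forall>\<^sub>F s in nhds t. \<forall>i\<in>top t. x s i = x t i"
      using x_const top_pos finite_subset[OF top_sub] by (simp add: eventually_ball_finite)
    moreover have "\<forall>\<^sub>F s in nhds t. \<forall>j\<in>{..N} - top t. w j s < w i s"
    proof -
      have "\<forall>\<^sub>F s in nhds t. w j s < w i s" if j: "j \<in> {..N} - top t" for j
      proof -
        have "w j t < w i t" using i j by (force simp: top_def not_le)
        moreover have "((\<lambda>s. w i s - w j s) \<longlongrightarrow> w i t - w j t) (nhds t)"
          using w_cont by (intro tendsto_diff)
            (auto simp: continuous_on_eq_continuous_at isCont_def tendsto_nhds_iff)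
        ultimately have "\<forall>\<^sub>F s in nhds t. 0 < w i s - w j s"
          by (intro order_tendstoD) auto
        then show ?thesis by eventually_elim simp
      qed
      then show ?thesis by (simp add: eventually_ball_finite)
    qed
    \<comment> \<open>\<open>2 * R\<close> bounds \<open>norm (l - k)\<close>, hence the change of
      the margin when \<open>u t\<close> becomes \<open>u s\<close>.\<close>
    moreover have "\<forall>\<^sub>F s in nhds t. 2 * R * norm (u s - u t) + cc s / 2 < cc t"
    proof -
      have "((\<lambda>s. 2 * R * norm (u s - u t) + cc s / 2) \<longlongrightarrow> 2 * R * norm (u t - u t) + cc t / 2) (nhds t)"
        using u_cont cc_cont by (intro tendsto_intros) (auto simp: isCont_def tendsto_nhds_iff)
      from order_tendstoD(2)[OF this, of "cc t"] show ?thesis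
        using cc_pos[of t] by simp
    qed
    ultimately have "\<forall>\<^sub>F s in nhds t. l \<in> \<Phi> s"
    proof eventually_elim
      case (elim s)
      have "x s j + l \<in> K" if "j \<in> top s" for j
      proof -
        have "i \<le> N" "j \<le> N"
          using that i top_sub by blast+
        then have "w i s \<le> w j s"
          using that by (simp add: top_def)
        then have "j \<in> top t"
          using elim(2) \<open>j \<le> N\<close> by (metis DiffI atMost_iff not_le)
        then show ?thesis
          using elim(1) l(1) by (auto simp: mem_minkowski_diff)
      qed
      moreover have "k \<bullet> u s + cc s / 2 \<le> l \<bullet> u s" if k: "k \<in> K" for k
      proof -
        have "\<bar>(l - k) \<bullet> (u s - u t)\<bar> \<le> norm (l - k) * norm (u s - u t)"
          by (rule Cauchy_Schwarz_ineq2)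
        also have "\<dots> \<le> 2 * R * norm (u s - u t)"
          using norm_triangle_ineq4[of l k] lR R(2)[OF k] by (intro mult_right_mono) auto
        finally show ?thesis
          using l(2)[OF k] elim(3) by (simp add: inner_diff)
      qed
      ultimately show ?case by (simp add: \<Phi>_def)
    qed
    then show "\<exists>y\<in>B. \<forall>\<^sub>F s in nhds t. y \<in> \<Phi> s"
      using lR by (intro bexI[of _ l]) (auto simp: B_def)
  qed
  then obtain t where t: "t \<in> B" "t \<in> \<Phi> t" by blast
  \<comment> \<open>The margin \<open>cc t / 2\<close> against
    \<open>norm (u t) \<le> C * cc t\<close> keeps \<open>t\<close> away from \<open>K\<close>; the
    weight \<open>cc t\<close> cancels.\<close>
  have "1 / (2 * C) \<le> dist t k" if "k \<in> K" for k
  proof -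
    have "cc t / 2 \<le> (t - k) \<bullet> u t"
      using t(2) that by (auto simp: \<Phi>_def inner_diff)
    also have "\<dots> \<le> norm (t - k) * norm (u t)"
      by (rule norm_cauchy_schwarz)
    also have "\<dots> \<le> dist t k * (C * cc t)"
      using u_norm by (simp add: dist_norm mult_left_mono)
    finally have "cc t * 1 \<le> cc t * (dist t k * (2 * C))"
      by (simp add: algebra_simps)
    then show ?thesis
      using cc_pos[of t] C(1) by (simp add: pos_divide_le_eq)
  qed
  then have "t \<in> P" using t(1) by (simp add: P_def)
  obtain i where i: "i \<in> top t" using top_ne by auto
  then have "x t i + t \<in> K" using t(2) by (auto simp: \<Phi>_def)
  moreover have "x t i + t \<notin> K"
    using \<xi>(2)[of i t] i \<open>t \<in> P\<close> by (auto simp: x_def top_def)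
  ultimately show False by simp
qed

end
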